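(* Let $\kappa<\lambda$ be cardinals with $\mathrm{cf}(\lambda)=\kappa$ and $2^{<\lambda}=\lambda$, and let $U$ be a normal, fine ultrafilter on $P_\kappa(\lambda)$. Then $\mathrm{Gal}(U,\kappa,\lambda^+)$.
   Context: $P_\kappa(\lambda)=\{x\subseteq\lambda : |x|<\kappa\}$. An ultrafilter $U$ on $P_\kappa(\lambda)$ is fine if $\{x\in P_\kappa(\lambda):\alpha\in x\}\in U$ for every $\alpha<\lambda$, and normal if whenever $X_\alpha\in U$ for $\alpha<\lambda$, the diagonal intersection $\triangle_{\alpha<\lambda}X_\alpha=\{x\in P_\kappa(\lambda):\forall\alpha\in x\,(x\in X_\alpha)\}$ is in $U$. For a filter $F$ and cardinals $\mu\le\nu$, $\mathrm{Gal}(F,\mu,\nu)$ means: for every sequence $\langle A_i:i<\nu\rangle$ of sets in $F$ there is $I\subseteq\nu$ with $|I|=\mu$ such that $\bigcap_{i\in I}A_i\in F$.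
   Formalization: The ultrafilter U is additionally assumed to be κ-complete (the usual convention); without it, a normal fine ultrafilter on P_δ(λ) with δ<κ, lifted to P_κ(λ), refutes the claim. *)

theory Defs
  imports Main
begin

unbundle cardinal_syntax

text \<open>
  A cardinal is a relation satisfying \<^const>\<open>Card_order\<close>. Its underlying set of ordinals is its
  field, so the ordinals \<open>\<alpha> < \<lambda>\<close> are the elements of \<open>Field lam\<close>. Cardinals on different types are
  compared with \<open><o\<close>, \<open>\<le>o\<close> and \<open>=o\<close>.
\<close>

definition P_card :: "'k rel \<Rightarrow> 'a rel \<Rightarrow> 'a set set" where
  "P_card kap lam = {x. x \<subseteq> Field lam \<and> |x| <o kap}"

text \<open>
  The library's \<^const>\<open>cofinal\<close> is strict, so no subset of a nonzero finite cardinal is cofinal and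
  \<open>has_cof\<close> then fails; for infinite cardinals strict and non-strict cofinality agree.
\<close>

definition has_cof :: "'a rel \<Rightarrow> 'k rel \<Rightarrow> bool" where
  "has_cof lam kap \<longleftrightarrow>
     (\<exists>A \<subseteq> Field lam. cofinal A lam \<and> |A| =o kap) \<and>
     (\<forall>A \<subseteq> Field lam. cofinal A lam \<longrightarrow> kap \<le>o |A| )"

text \<open>
  For the supremum to be least it is enough to compare it with the cardinals \<open>|A|\<close> where
  \<open>A \<subseteq> Field s\<close>, since every cardinal below \<open>s\<close> is of this form.
\<close>

definition is_card_sup :: "'b rel set \<Rightarrow> 's rel \<Rightarrow> bool" where
  "is_card_sup R s \<longleftrightarrow>
     Card_order s \<and> (\<forall>r \<in> R. r \<le>o s) \<and>
     (\<forall>A \<subseteq> Field s. (\<forall>r \<in> R. r \<le>o |A| ) \<longrightarrow> s \<le>o |A| )"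

text \<open>
  \<open>two_pow_less_is lam s\<close> says \<open>2\<^bsup><\<lambda>\<^esup> = s\<close>, where \<open>2\<^bsup><\<lambda>\<^esup>\<close> is the supremum of \<open>2\<^bsup>\<mu>\<^esup>\<close> over all cardinals
  \<open>\<mu> < \<lambda>\<close>; each such \<open>\<mu>\<close> is \<open>|S|\<close> for some \<open>S \<subseteq> Field lam\<close>.
\<close>

definition two_pow_less_is :: "'a rel \<Rightarrow> 's rel \<Rightarrow> bool" where
  "two_pow_less_is lam s \<longleftrightarrow>
     is_card_sup {ctwo ^c |S| | S. S \<subseteq> Field lam \<and> |S| <o lam} s"

text \<open>
  A filter on a set \<open>Z\<close> is a library filter \<open>F \<le> principal Z\<close>; membership of a set \<open>X\<close> in it is
  \<open>\<forall>\<^sub>F x in F. x \<in> X\<close>. Only the trace of \<open>X\<close> on \<open>Z\<close> matters.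
\<close>

definition ultrafilter_on :: "'x set \<Rightarrow> 'x filter \<Rightarrow> bool" where
  "ultrafilter_on Z F \<longleftrightarrow>
     F \<le> principal Z \<and> F \<noteq> bot \<and>
     (\<forall>X \<subseteq> Z. (\<forall>\<^sub>F x in F. x \<in> X) \<or> (\<forall>\<^sub>F x in F. x \<in> Z - X))"

definition complete_filter :: "'k rel \<Rightarrow> 'x filter \<Rightarrow> bool" where
  "complete_filter kap F \<longleftrightarrow>
     (\<forall>\<X>. |\<X>| <o kap \<longrightarrow> (\<forall>X \<in> \<X>. \<forall>\<^sub>F x in F. x \<in> X) \<longrightarrow> (\<forall>\<^sub>F x in F. \<forall>X \<in> \<X>. x \<in> X))"

definition fine :: "'k rel \<Rightarrow> 'a rel \<Rightarrow> 'a set filter \<Rightarrow> bool" where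
  "fine kap lam F \<longleftrightarrow>
     (\<forall>\<alpha> \<in> Field lam. \<forall>\<^sub>F x in F. x \<in> {x \<in> P_card kap lam. \<alpha> \<in> x})"

definition diag_Inter :: "'k rel \<Rightarrow> 'a rel \<Rightarrow> ('a \<Rightarrow> 'a set set) \<Rightarrow> 'a set set" where
  "diag_Inter kap lam X = {x \<in> P_card kap lam. \<forall>\<alpha> \<in> x. x \<in> X \<alpha>}"

definition normal :: "'k rel \<Rightarrow> 'a rel \<Rightarrow> 'a set filter \<Rightarrow> bool" where
  "normal kap lam F \<longleftrightarrow>
     (\<forall>X. (\<forall>\<alpha> \<in> Field lam. \<forall>\<^sub>F x in F. x \<in> X \<alpha>) \<longrightarrow> (\<forall>\<^sub>F x in F. x \<in> diag_Inter kap lam X))"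

text \<open>
  An ultrafilter on \<open>P\<^sub>\<kappa>(\<lambda>)\<close> is, as usual, understood to be \<open>\<kappa>\<close>-complete. This does not follow from
  fineness and normality as defined above: for \<open>\<delta> < \<kappa>\<close>, a normal fine ultrafilter on \<open>P\<^sub>\<delta>(\<lambda>)\<close>
  generates one on \<open>P\<^sub>\<kappa>(\<lambda>)\<close> which is not \<open>\<kappa>\<close>-complete.
\<close>

definition normal_fine_ultrafilter :: "'k rel \<Rightarrow> 'a rel \<Rightarrow> 'a set filter \<Rightarrow> bool" where
  "normal_fine_ultrafilter kap lam U \<longleftrightarrow>
     ultrafilter_on (P_card kap lam) U \<and> complete_filter kap U \<and>
     fine kap lam U \<and> normal kap lam U"

definition Gal :: "'x filter \<Rightarrow> 'm rel \<Rightarrow> 'n rel \<Rightarrow> bool" where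
  "Gal F mu nu \<longleftrightarrow>
     (\<forall>A. (\<forall>i \<in> Field nu. \<forall>\<^sub>F x in F. x \<in> A i) \<longrightarrow>
       (\<exists>I \<subseteq> Field nu. |I| =o mu \<and> (\<forall>\<^sub>F x in F. x \<in> (\<Inter>i \<in> I. A i))))"

end

theory Submission
  imports Defs
begin

text \<open>
  This adapts Galvin's argument to \<open>P\<^sub>\<kappa>(\<lambda>)\<close>. Write \<open>\<lambda>\<close> as an increasing union of bounded sets \<open>L\<^sub>k\<close>,
  \<open>k < \<kappa>\<close>. By Koenig's theorem \<open>\<lambda>\<close> is a strong limit, so the traces \<open>A\<^sub>j \<inter> Pow L\<^sub>k\<close> take at most \<open>\<lambda>\<close>
  values, and some \<open>i < \<lambda>\<^sup>+\<close> has, for every \<open>k\<close>, the same trace at \<open>k\<close> as more than \<open>\<lambda>\<close> indices \<open>j\<close>.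
  Choose distinct such indices \<open>f k\<close>, and let \<open>h\<close> be a cofinal injection of \<open>\<kappa>\<close> into \<open>\<lambda>\<close>.
  If \<open>h k \<in> x\<close>, then \<open>x\<close> is put into \<open>A\<^bsub>f k\<^esub>\<close> by a diagonal intersection; if \<open>h k \<notin> x\<close>, then for
  \<open>U\<close>-almost all \<open>x\<close> we have \<open>x \<subseteq> L\<^sub>k\<close>, so \<open>x \<in> A\<^sub>i\<close> already gives \<open>x \<in> A\<^bsub>f k\<^esub>\<close>.
\<close>

section \<open>Infinitude, Koenig's theorem and the strong limit property\<close>

text \<open>In a finite nonempty well-order some element has the most predecessors, and strict
  cofinality would supply one with more.\<close>

lemma cofinal_imp_infinite_Field:
  assumes "Well_order r" and "Field r \<noteq> {}" and "cofinal A r"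
  shows "infinite (Field r)"
proof
  assume fin: "finite (Field r)"
  interpret r: wo_rel r using assms(1) by (simp add: wo_rel_def)
  let ?c = "\<lambda>a. card (under r a)"
  have "Max (?c ` Field r) \<in> ?c ` Field r"
    using fin assms(2) by (intro Max_in) auto
  then obtain a where a: "a \<in> Field r" and "?c a = Max (?c ` Field r)"
    by auto
  then have max: "?c b \<le> ?c a" if "b \<in> Field r" for b
    using fin that by simp
  obtain b where b: "a \<noteq> b" "(a, b) \<in> r"
    using a assms(3) by (auto simp: cofinal_def)
  then have bF: "b \<in> Field r" by (auto simp: Field_def)
  have "under r a \<subset> under r b"
  proof
    show "under r a \<subseteq> under r b"
      using b r.TRANS by (auto simp: under_def dest: transD)
    show "under r a \<noteq> under r b"
      using b bF r.ANTISYM r.REFL by (auto simp: under_def antisym_def refl_on_def)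
  qed
  moreover have "finite (under r b)"
    using fin under_Field finite_subset by metis
  ultimately have "?c a < ?c b" by (rule psubset_card_mono[rotated])
  then show False using max[OF bF] by simp
qed

lemma card_of_Pow_ordLeq:
  assumes "two_pow_less_is lam s" and "|T| <o lam"
  shows "|Pow T| \<le>o s"
proof -
  \<comment> \<open>\<open>T\<close> may live on any type, whereas \<open>two_pow_less_is\<close>
    speaks only of subsets of \<open>Field lam\<close>; hence the copy \<open>B\<close>.\<close>
  obtain B where B: "B \<subseteq> Field lam" "|T| =o |B|" "|B| <o lam"
    using assms(2) internalize_card_of_ordLess[of T lam] by blast
  have "|Pow T| =o ctwo ^c |T|"
    unfolding ctwo_def cexp_def Field_card_of by (rule card_of_Pow_Func)
  also have "ctwo ^c |T| =o ctwo ^c |B|"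
    using B(2) by (intro cexp_cong2 Card_order_ctwo card_of_Card_order)
  also have "ctwo ^c |B| \<le>o s"
    using assms(1) B by (auto simp: two_pow_less_is_def is_card_sup_def)
  finally show ?thesis .
qed

text \<open>Both factors embed in the sum \<open>A <+> B\<close>, whose square is either finite or
  equinumerous with the sum.\<close>

lemma card_of_Times_ordLess:
  assumes "Card_order r" and "infinite (Field r)" and "|A| <o r" and "|B| <o r"
  shows "|A \<times> B| <o r"
proof -
  let ?T = "A <+> B"
  have T: "|?T| <o r" using assms by (intro card_of_Plus_ordLess_infinite_Field)
  have "|A \<times> B| \<le>o |?T \<times> ?T|"
    by (rule card_of_ordLeqI[where f = "map_prod Inl Inr"]) (auto simp: inj_on_def)
  moreover have "|?T \<times> ?T| <o r"
  proof (cases "finite ?T")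
    case True
    then have "finite (Field |?T \<times> ?T| )" by (simp add: Field_card_of)
    then show ?thesis
      using assms(1,2) by (intro finite_ordLess_infinite)
        (auto simp: card_of_Well_order card_order_on_well_order_on)
  next
    case False
    then have "|?T \<times> ?T| =o |?T|" by (rule card_of_Times_same_infinite)
    then show ?thesis using T ordIso_ordLess_trans by blast
  qed
  ultimately show ?thesis by (rule ordLeq_ordLess_trans)
qed

text \<open>Koenig's theorem, \<open>\<lambda> < \<lambda>\<^bsup>cf(\<lambda>)\<^esup>\<close>, by diagonalisation along a cofinal map \<open>h\<close>.\<close>

lemma not_card_of_Func_ordLeq:
  assumes r: "Card_order r" and ne: "Field r \<noteq> {}"
    and h: "\<And>b. b \<in> Field r \<Longrightarrow> \<exists>k \<in> K. h k \<in> Field r \<and> b \<in> underS r (h k)"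
  shows "\<not> |Func K (Field r)| \<le>o |Field r|"
proof
  assume "|Func K (Field r)| \<le>o |Field r|"
  moreover have "Func K (Field r) \<noteq> {}"
    using ne by (simp add: Func_is_emp)
  ultimately obtain \<Phi> where \<Phi>: "\<Phi> ` Field r = Func K (Field r)"
    using card_of_ordLeq2 by metis
  \<comment> \<open>Fewer than \<open>r\<close> functions are indexed below \<open>h k\<close>, so
    their values at \<open>k\<close> leave a point of \<open>Field r\<close> free. A function
    choosing free points differs from all of them.\<close>
  have ex: "\<exists>v. v \<in> Field r - (\<lambda>b. \<Phi> b k) ` underS r (h k)" if "h k \<in> Field r" for k
  proof (rule ccontr)
    assume "\<not> ?thesis"
    then have "|Field r| \<le>o |underS r (h k)|"
      by (intro surj_imp_ordLeq) auto
    also have "|underS r (h k)| <o r" by (rule card_of_underS[OF r that])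
    also have "r =o |Field r|" using r card_of_Field_ordIso ordIso_symmetric by blast
    finally show False using not_ordLess_ordLeq by (metis ordLess_irreflexive)
  qed
  define f where "f k = (if k \<in> K then
      if h k \<in> Field r then SOME v. v \<in> Field r - (\<lambda>b. \<Phi> b k) ` underS r (h k)
      else SOME v. v \<in> Field r else undefined)" for k
  have f1: "f k \<in> Field r - (\<lambda>b. \<Phi> b k) ` underS r (h k)" if "k \<in> K" "h k \<in> Field r" for k
    using someI_ex[OF ex[OF that(2)]] that by (simp add: f_def)
  have "f k \<in> Field r" if "k \<in> K" for k
    using f1[OF that] that ne by (cases "h k \<in> Field r") (auto simp: f_def some_in_eq)
  then have "f \<in> Func K (Field r)" by (auto simp: Func_def f_def)
  then obtain b where b: "b \<in> Field r" "f = \<Phi> b" using \<Phi> by auto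
  then obtain k where "k \<in> K" "h k \<in> Field r" "b \<in> underS r (h k)" using h by blast
  with f1[of k] b show False by auto
qed

text \<open>The hypothesis on powers gives only \<open>\<le>o\<close>; Koenig's theorem excludes
  equality.\<close>

lemma card_of_Pow_ordLess:
  assumes r: "Card_order r" and inf: "infinite (Field r)"
    and K: "|K| <o r"
    and h: "\<And>b. b \<in> Field r \<Longrightarrow> \<exists>k \<in> K. h k \<in> Field r \<and> b \<in> underS r (h k)"
    and two: "two_pow_less_is r r" and L: "|L| <o r"
  shows "|Pow L| <o r"
proof (rule ccontr)
  assume "\<not> ?thesis"
  then have "r \<le>o |Pow L|"
    using r by (simp add: card_of_Well_order card_order_on_well_order_on flip: not_ordLess_iff_ordLeq)
  then have "|Field r| \<le>o |Pow L|"
    using r card_of_Field_ordIso ordIso_ordLeq_trans by blast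
  then obtain j where j: "inj_on j (Field r)" "j ` Field r \<subseteq> Pow L"
    using card_of_ordLeq by metis
  \<comment> \<open>Otherwise \<open>\<lambda>\<^bsup>K\<^esup> \<le> (2\<^bsup>L\<^esup>)\<^bsup>K\<^esup> = 2\<^bsup>K \<times> L\<^esup> \<le> \<lambda>\<close>.\<close>
  define G where "G F = {(k, l). k \<in> K \<and> l \<in> j (F k)}" for F
  \<comment> \<open>The section of \<open>G F\<close> at \<open>k\<close> is \<open>j (F k)\<close>,
    which determines \<open>F k\<close>; off \<open>K\<close> all members of \<open>Func\<close> are
    \<open>undefined\<close>.\<close>
  have "inj_on G (Func K (Field r))"
  proof (rule inj_onI)
    fix F F' assume F: "F \<in> Func K (Field r)" "F' \<in> Func K (Field r)" and eq: "G F = G F'"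
    show "F = F'"
    proof
      fix k
      show "F k = F' k"
      proof (cases "k \<in> K")
        case True
        then have "j (F k) = j (F' k)" using eq by (auto simp: G_def set_eq_iff)
        then show ?thesis using True F j(1) by (auto simp: Func_def dest: inj_onD)
      qed (use F in \<open>auto simp: Func_def\<close>)
    qed
  qed
  moreover have "G ` Func K (Field r) \<subseteq> Pow (K \<times> L)"
    using j(2) by (fastforce simp: G_def Func_def)
  ultimately have "|Func K (Field r)| \<le>o |Pow (K \<times> L)|"
    using card_of_ordLeq by metis
  also have "|Pow (K \<times> L)| \<le>o r"
    by (intro card_of_Pow_ordLeq[OF two] card_of_Times_ordLess inf r K L)
  also have "r =o |Field r|" using r card_of_Field_ordIso ordIso_symmetric by blast
  finally show False
    using not_card_of_Func_ordLeq[OF r infinite_imp_nonempty[OF inf] h] by contradiction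
qed

section \<open>Pigeonhole and injective choice\<close>

text \<open>If every index had a small fibre at some \<open>k\<close>, then \<open>J\<close> would
  be covered by at most \<open>r\<close> fibres for each of at most \<open>r\<close> many
  \<open>k\<close>, all of size at most \<open>r\<close>.\<close>

lemma exists_all_fibres_large:
  assumes r: "Card_order r" and inf: "infinite (Field r)"
    and K: "|K| \<le>o r" and c: "\<And>k. k \<in> K \<Longrightarrow> |c k ` J| \<le>o r" and J: "r <o |J|"
  shows "\<exists>i \<in> J. \<forall>k \<in> K. r <o |{j \<in> J. c k j = c k i}|"
proof (rule ccontr)
  let ?S = "\<lambda>k. {v \<in> c k ` J. |{j \<in> J. c k j = v}| \<le>o r}"
  assume neg: "\<not> ?thesis"
  have "J \<subseteq> (\<Union>k \<in> K. \<Union>v \<in> ?S k. {j \<in> J. c k j = v})"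
  proof
    fix i assume i: "i \<in> J"
    then obtain k where k: "k \<in> K" "\<not> r <o |{j \<in> J. c k j = c k i}|" using neg by blast
    then have "|{j \<in> J. c k j = c k i}| \<le>o r"
      using r by (simp add: card_of_Well_order card_order_on_well_order_on flip: not_ordLess_iff_ordLeq)
    with i k show "i \<in> (\<Union>k \<in> K. \<Union>v \<in> ?S k. {j \<in> J. c k j = v})" by blast
  qed
  then have "|J| \<le>o |\<Union>k \<in> K. \<Union>v \<in> ?S k. {j \<in> J. c k j = v}|" by (rule card_of_mono1)
  also have "|\<Union>k \<in> K. \<Union>v \<in> ?S k. {j \<in> J. c k j = v}| \<le>o r"
  proof (intro card_of_UNION_ordLeq_infinite_Field[OF inf r] K ballI)
    fix k assume "k \<in> K"
    have "|?S k| \<le>o |c k ` J|" by (intro card_of_mono1) auto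
    with c[OF \<open>k \<in> K\<close>] show "|?S k| \<le>o r" using ordLeq_transitive by blast
  qed auto
  finally show False using J not_ordLess_ordLeq by blast
qed

text \<open>Recursion along \<open>r\<close>: a proper initial segment of a cardinal is smaller than
  it, so the values used before stage \<open>k\<close> cannot exhaust \<open>H k\<close>.\<close>

lemma exists_injective_choice:
  assumes r: "Card_order r" and H: "\<And>k. k \<in> Field r \<Longrightarrow> r \<le>o |H k|"
  shows "\<exists>f. inj_on f (Field r) \<and> (\<forall>k \<in> Field r. f k \<in> H k)"
proof -
  interpret r: wo_rel r using r by (simp add: wo_rel_def card_order_on_well_order_on)
  define R where "R f k = (SOME v. v \<in> H k - f ` underS r k)" for f k
  define f where "f = r.worec R"
  \<comment> \<open>\<open>R f k\<close> depends on \<open>f\<close> only through its image of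
    \<open>underS r k\<close>.\<close>
  have "r.adm_wo R"
    unfolding r.adm_wo_def R_def by (metis image_cong)
  then have f_eq: "f k = R f k" for k
    using r.worec_fixpoint unfolding f_def by metis
  have f: "f k \<in> H k - f ` underS r k" if k: "k \<in> Field r" for k
  proof -
    have "\<exists>v. v \<in> H k - f ` underS r k"
    proof (rule ccontr)
      assume "\<not> ?thesis"
      then have "H k \<subseteq> f ` underS r k" by auto
      then have "|H k| \<le>o |underS r k|" by (rule surj_imp_ordLeq)
      also have "|underS r k| <o r" by (rule card_of_underS[OF r k])
      finally show False using H[OF k] not_ordLess_ordLeq by blast
    qed
    then show ?thesis unfolding f_eq[of k] R_def by (rule someI_ex)
  qed
  have "inj_on f (Field r)"
  proof (rule inj_onI, rule ccontr)
    fix k l assume kl: "k \<in> Field r" "l \<in> Field r" "f k = f l" "k \<noteq> l"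
    then consider "k \<in> underS r l" | "l \<in> underS r k"
      using r.TOTALS by (auto simp: underS_def)
    then show False using f[OF kl(1)] f[OF kl(2)] kl(3) by cases (metis DiffD2 imageI)+
  qed
  with f show ?thesis by blast
qed

section \<open>Closure properties of almost every \<open>x\<close>\<close>

lemma eventually_diag_Inter:
  assumes "normal_fine_ultrafilter kap lam U"
    and "\<And>a. a \<in> Field lam \<Longrightarrow> \<forall>\<^sub>F x in U. x \<in> X a"
  shows "\<forall>\<^sub>F x in U. x \<in> diag_Inter kap lam X"
  using assms unfolding normal_fine_ultrafilter_def normal_def by blast

text \<open>This confines \<open>x\<close>: if \<open>e k \<notin> x\<close>, then
  \<open>g a\<close> precedes \<open>k\<close> for every \<open>a \<in> x\<close>. Completeness
  settles each initial segment, and normality treats all \<open>k\<close> at once.\<close>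

lemma eventually_closed:
  assumes U: "normal_fine_ultrafilter kap lam U" and kap: "Card_order kap"
    and e: "inj_on e (Field kap)" "e ` Field kap \<subseteq> Field lam"
    and g: "\<And>a. a \<in> Field lam \<Longrightarrow> g a \<in> Field kap"
  shows "\<forall>\<^sub>F x in U. x \<subseteq> Field lam \<and> (\<forall>a \<in> x. e (g a) \<in> x) \<and>
    (\<forall>k \<in> Field kap. e k \<in> x \<longrightarrow> e ` underS kap k \<subseteq> x)"
proof -
  have fine: "\<forall>\<^sub>F x in U. a \<in> x" if "a \<in> Field lam" for a
    using U that by (auto simp: normal_fine_ultrafilter_def fine_def elim!: eventually_mono)
  have complete: "\<forall>\<^sub>F x in U. \<forall>X \<in> \<X>. x \<in> X"
    if "|\<X>| <o kap" "\<And>X. X \<in> \<X> \<Longrightarrow> \<forall>\<^sub>F x in U. x \<in> X" for \<X>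
    using U that unfolding normal_fine_ultrafilter_def complete_filter_def by blast
  note diag = eventually_diag_Inter[OF U]
  have initial: "\<forall>\<^sub>F x in U. e ` underS kap k \<subseteq> x" if k: "k \<in> Field kap" for k
  proof -
    have "|(\<lambda>l. {x. e l \<in> x}) ` underS kap k| <o kap"
      using card_of_image card_of_underS[OF kap k] by (rule ordLeq_ordLess_trans)
    moreover have "e l \<in> Field lam" if "l \<in> underS kap k" for l
      using that e(2) underS_Field by fast
    ultimately have "\<forall>\<^sub>F x in U. \<forall>X \<in> (\<lambda>l. {x. e l \<in> x}) ` underS kap k. x \<in> X"
      using fine by (intro complete) auto
    then show ?thesis by (rule eventually_mono) auto
  qed
  have "\<forall>\<^sub>F x in U. x \<in> diag_Inter kap lam (\<lambda>a. {x. e (g a) \<in> x})"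
    using fine e(2) g by (intro diag) auto
  \<comment> \<open>Diagonal intersections are indexed by \<lambda>, so \<open>k\<close> is coded as
    \<open>e k\<close>; points outside the range of \<open>e\<close> impose no condition.\<close>
  moreover have "\<forall>\<^sub>F x in U. x \<in> diag_Inter kap lam
      (\<lambda>a. {x. a \<in> e ` Field kap \<longrightarrow> e ` underS kap (inv_into (Field kap) e a) \<subseteq> x})"
  proof (intro diag)
    fix a
    show "\<forall>\<^sub>F x in U. x \<in> {x. a \<in> e ` Field kap \<longrightarrow>
        e ` underS kap (inv_into (Field kap) e a) \<subseteq> x}"
      using initial[of "inv_into (Field kap) e a"]
      by (cases "a \<in> e ` Field kap") (auto simp: inv_into_into)
  qed
  ultimately show ?thesis
  proof eventually_elim
    case (elim x)
    then show ?case
      using e(1) by (fastforce simp: diag_Inter_def P_card_def)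
  qed
qed

theorem theorem2p15:
  fixes kap :: "'k rel" and lam :: "'a rel" and U :: "'a set filter"
  assumes "Card_order kap" and "Card_order lam" and "kap <o lam"
    and "has_cof lam kap"
    and "two_pow_less_is lam lam"
    and "normal_fine_ultrafilter kap lam U"
  shows "Gal U kap (cardSuc lam)"
  unfolding Gal_def
proof (intro allI impI)
  fix A assume A: "\<forall>i \<in> Field (cardSuc lam). \<forall>\<^sub>F x in U. x \<in> A i"
  let ?J = "Field (cardSuc lam)"
  note kap = assms(1) and lam = assms(2)
  interpret lam: wo_rel lam using lam by (simp add: wo_rel_def card_order_on_well_order_on)
  interpret kap: wo_rel kap using kap by (simp add: wo_rel_def card_order_on_well_order_on)
  have kap_Field: "|Field kap| =o kap" and lam_Field: "|Field lam| =o lam"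
    using kap lam card_of_Field_ordIso by auto
  have kap_less: "|Field kap| <o lam"
    using kap_Field assms(3) ordIso_ordLess_trans by blast
  obtain C where C: "C \<subseteq> Field lam" "cofinal C lam" "|C| =o kap"
    and least: "\<And>B. B \<subseteq> Field lam \<Longrightarrow> cofinal B lam \<Longrightarrow> kap \<le>o |B|"
    using assms(4) by (auto simp: has_cof_def)
  have "Field lam \<noteq> {}"
  proof
    assume "Field lam = {}"
    then have "|Field lam| \<le>o |Field kap|" by (simp add: card_of_empty)
    then have "|Field lam| <o lam" using kap_less ordLeq_ordLess_trans by blast
    then show False using lam_Field not_ordLess_ordIso by blast
  qed
  then have inf: "infinite (Field lam)"
    using cofinal_imp_infinite_Field[OF lam.WELL _ C(2)] by blast
  have "|Field kap| =o |C|"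
    using kap_Field C(3) ordIso_symmetric ordIso_transitive by blast
  then obtain h where h: "bij_betw h (Field kap) C"
    using card_of_ordIso by metis
  have h_Field: "h k \<in> Field lam" if "k \<in> Field kap" for k
    using that h C(1) by (auto simp: bij_betw_def)
  have "\<exists>k \<in> Field kap. a \<in> underS lam (h k)" if "a \<in> Field lam" for a
    using that C(2) h by (fastforce simp: cofinal_def underS_def bij_betw_def)
  then obtain g where g: "\<And>a. a \<in> Field lam \<Longrightarrow> g a \<in> Field kap \<and> a \<in> underS lam (h (g a))"
    by metis
  then have "\<exists>k \<in> Field kap. h k \<in> Field lam \<and> a \<in> underS lam (h k)" if "a \<in> Field lam" for a
    using that h_Field by blast
  note Pow_less = card_of_Pow_ordLess[OF lam inf kap_less this assms(5)]
  \<comment> \<open>Only \<open>l\<close> strictly before \<open>k\<close> enter, matching the case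
    \<open>h k \<notin> x\<close>, in which every \<open>g a\<close> with \<open>a \<in> x\<close>
    precedes \<open>k\<close>.\<close>
  define L where "L k = (\<Union>l \<in> underS kap k. underS lam (h l))" for k
  have L_less: "|L k| <o lam" if k: "k \<in> Field kap" for k
  proof -
    have sub: "h ` underS kap k \<subseteq> Field lam"
      using underS_Field h_Field by fast
    have "|h ` underS kap k| <o kap"
      using card_of_image card_of_underS[OF kap k] by (rule ordLeq_ordLess_trans)
    \<comment> \<open>Fewer than cf(\<lambda>) points have a bound \<open>b\<close>. A non-strict
      bound suffices, since \<open>L k\<close> is built from strict segments.\<close>
    then have "\<not> cofinal (h ` underS kap k) lam"
      using least[OF sub] not_ordLess_ordLeq by blast
    then obtain b where b: "b \<in> Field lam"
      and "\<And>l. l \<in> underS kap k \<Longrightarrow> b = h l \<or> (b, h l) \<notin> lam"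
      by (auto simp: cofinal_def)
    then have le: "(h l, b) \<in> lam" if "l \<in> underS kap k" for l
      using that sub lam.TOTALS by (metis image_subset_iff)
    have "L k \<subseteq> underS lam b"
    proof
      fix a assume "a \<in> L k"
      then obtain l where l: "l \<in> underS kap k" "a \<noteq> h l" "(a, h l) \<in> lam"
        by (auto simp: L_def underS_def)
      then have "(a, b) \<in> lam" using le lam.TRANS by (meson transD)
      moreover have "a \<noteq> b" using l le lam.ANTISYM by (auto simp: antisym_def)
      ultimately show "a \<in> underS lam b" by (simp add: underS_def)
    qed
    then have "|L k| \<le>o |underS lam b|" by (rule card_of_mono1)
    then show ?thesis using card_of_underS[OF lam b] ordLeq_ordLess_trans by blast
  qed
  have "\<exists>i \<in> ?J. \<forall>k \<in> Field kap. lam <o |{j \<in> ?J. A j \<inter> Pow (L k) = A i \<inter> Pow (L k)}|"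
  proof (rule exists_all_fibres_large[OF lam inf])
    show "|Field kap| \<le>o lam" using kap_less ordLess_imp_ordLeq by blast
    show "|(\<lambda>j. A j \<inter> Pow (L k)) ` ?J| \<le>o lam" if "k \<in> Field kap" for k
    proof -
      \<comment> \<open>A trace is a subset of \<open>Pow (L k)\<close>, so the strong limit
        property is applied twice.\<close>
      have "|(\<lambda>j. A j \<inter> Pow (L k)) ` ?J| \<le>o |Pow (Pow (L k))|"
        by (intro card_of_mono1) auto
      also have "|Pow (Pow (L k))| \<le>o lam"
        by (intro ordLess_imp_ordLeq Pow_less L_less that)
      finally show ?thesis .
    qed
    show "lam <o |?J|"
      using cardSuc_greater[OF lam] card_of_Field_ordIso[OF cardSuc_Card_order[OF lam]]
        ordIso_symmetric ordLess_ordIso_trans by blast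
  qed
  then obtain i where i: "i \<in> ?J" and
    large: "\<And>k. k \<in> Field kap \<Longrightarrow> lam <o |{j \<in> ?J. A j \<inter> Pow (L k) = A i \<inter> Pow (L k)}|"
    by blast
  let ?H = "\<lambda>k. {j \<in> ?J. A j \<inter> Pow (L k) = A i \<inter> Pow (L k)}"
  have "kap \<le>o |?H k|" if "k \<in> Field kap" for k
    using large[OF that] assms(3) ordLess_imp_ordLeq ordLess_transitive by blast
  from exists_injective_choice[of kap ?H, OF kap this] obtain f where f_inj: "inj_on f (Field kap)"
    and f: "\<And>k. k \<in> Field kap \<Longrightarrow> f k \<in> ?J \<and> A (f k) \<inter> Pow (L k) = A i \<inter> Pow (L k)"
    by auto
  show "\<exists>I \<subseteq> ?J. |I| =o kap \<and> (\<forall>\<^sub>F x in U. x \<in> (\<Inter>i \<in> I. A i))"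
  proof (intro exI[of _ "f ` Field kap"] conjI)
    show "f ` Field kap \<subseteq> ?J" using f by blast
    have "|Field kap| =o |f ` Field kap|"
      using f_inj by (intro card_of_ordIsoI[of f]) (simp add: bij_betw_def)
    then show "|f ` Field kap| =o kap"
      using kap_Field ordIso_symmetric ordIso_transitive by blast
    \<comment> \<open>The requirement for \<open>k\<close> is placed at the coordinate
      \<open>h k\<close>, so it binds exactly those \<open>x\<close> containing
      \<open>h k\<close>.\<close>
    let ?D = "diag_Inter kap lam
      (\<lambda>a. {x. a \<in> h ` Field kap \<longrightarrow> x \<in> A (f (inv_into (Field kap) h a))})"
    have h_inj: "inj_on h (Field kap)" using h by (simp add: bij_betw_def)
    have "\<forall>\<^sub>F x in U. x \<in> A (f (inv_into (Field kap) h a))" if "a \<in> h ` Field kap" for a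
      using that A f by (simp add: inv_into_into)
    then have "\<forall>\<^sub>F x in U. x \<in> {x. a \<in> h ` Field kap \<longrightarrow> x \<in> A (f (inv_into (Field kap) h a))}"
      for a by (cases "a \<in> h ` Field kap") auto
    then have "\<forall>\<^sub>F x in U. x \<in> ?D"
      by (rule eventually_diag_Inter[OF assms(6)])
    moreover have "\<forall>\<^sub>F x in U. x \<in> A i" using A i by blast
    moreover have "\<forall>\<^sub>F x in U. x \<subseteq> Field lam \<and> (\<forall>a \<in> x. h (g a) \<in> x) \<and>
        (\<forall>k \<in> Field kap. h k \<in> x \<longrightarrow> h ` underS kap k \<subseteq> x)"
      using g h_Field by (intro eventually_closed[OF assms(6) kap h_inj]) auto
    ultimately show "\<forall>\<^sub>F x in U. x \<in> (\<Inter>i \<in> f ` Field kap. A i)"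
    proof eventually_elim
      case (elim x)
      have "x \<in> A (f k)" if k: "k \<in> Field kap" for k
      proof (cases "h k \<in> x")
        case True
        then show ?thesis using elim(1) k h_inj by (auto simp: diag_Inter_def)
      next
        case False
        have "a \<in> L k" if a: "a \<in> x" for a
        proof -
          have ga: "g a \<in> Field kap" "a \<in> underS lam (h (g a))" "h (g a) \<in> x"
            using a g elim(3) by blast+
          \<comment> \<open>Otherwise \<open>h (g a) \<in> x\<close> and closure under initial
            segments would put \<open>h k\<close> into \<open>x\<close>.\<close>
          have "k \<notin> underS kap (g a)" "k \<noteq> g a"
            using ga(1,3) elim(3) False by blast+
          then have "g a \<in> underS kap k"
            using k ga(1) kap.TOTALS by (auto simp: underS_def)
          then show ?thesis using ga(2) by (auto simp: L_def)
        qed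
        then show ?thesis using f[OF k] elim(2) by blast
      qed
      then show ?case by blast
    qed
  qed
qed

end
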